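(* For all $n\ge1$, $K_G^{+}(\ell_1^n,\ell_1^n)=K_G^{+}(\ell_1^n,\ell_\infty^n)\le K_G$.
   Context: Banach spaces are real. $\check\otimes$ and $\hat\otimes$ denote the injective and projective tensor products. For $E$ finite-dimensional and $F$ a Banach space, $$K_G^+(E,F)=\sup\{\|A\otimes\mathrm{id}_F\|_{E\check\otimes F\to E^*\hat\otimes F}: A:E\to E^*,\ A\ge0,\ \|A\|_{E\to E^*}\le1\},$$ where maps $E\to E^*$ are identified with elements of $E^*\otimes E^*$ and $A\ge0$ means $A$ is in the convex hull of $\{e^*\otimes e^*:e^*\in E^*\}$. $K_G$ is the (real) Grothendieck constant: the supremum of $|\sum_{i,j}a_{ij}\langle v_i,w_j\rangle|$ over all $m,n$, all unit vectors $v_i,w_j$ in real $\ell_2$, and all real $m\times n$ matrices $(a_{ij})$ with $\sup\{|\sum_{i,j}a_{ij}s_it_j|:|s_i|,|t_j|\le1\}\le1$. *)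

theory Defs
  imports "HOL-Analysis.Analysis"
begin

section \<open>The spaces \<open>\<ell>\<^sub>1\<^sup>n\<close> and \<open>\<ell>\<^sub>\<infinity>\<^sup>n\<close>\<close>

class finite_dim_normed = real_normed_vector +
  assumes finite_dim: "\<exists>B::'a set. finite B \<and> (\<forall>x. \<exists>c. x = (\<Sum>b\<in>B. c b *\<^sub>R b))"

text \<open>The coordinates are indexed by a finite type \<open>'n\<close>, so that \<open>n = CARD('n)\<close>; every
  \<open>n \<ge> 1\<close> arises in this way.\<close>

typedef 'n ell1 = "UNIV :: ('n::finite \<Rightarrow> real) set"
  morphisms ell1_nth Abs_ell1 ..

typedef 'n ellinf = "UNIV :: ('n::finite \<Rightarrow> real) set"
  morphisms ellinf_nth Abs_ellinf ..

setup_lifting type_definition_ell1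
setup_lifting type_definition_ellinf

instantiation ell1 :: (finite) real_normed_vector
begin

lift_definition zero_ell1 :: "'a ell1" is "\<lambda>i. 0" .
lift_definition plus_ell1 :: "'a ell1 \<Rightarrow> 'a ell1 \<Rightarrow> 'a ell1" is "\<lambda>x y i. x i + y i" .
lift_definition minus_ell1 :: "'a ell1 \<Rightarrow> 'a ell1 \<Rightarrow> 'a ell1" is "\<lambda>x y i. x i - y i" .
lift_definition uminus_ell1 :: "'a ell1 \<Rightarrow> 'a ell1" is "\<lambda>x i. - x i" .
lift_definition scaleR_ell1 :: "real \<Rightarrow> 'a ell1 \<Rightarrow> 'a ell1" is "\<lambda>r x i. r * x i" .
lift_definition norm_ell1 :: "'a ell1 \<Rightarrow> real" is "\<lambda>x. \<Sum>i\<in>UNIV. \<bar>x i\<bar>" .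

definition dist_ell1 :: "'a ell1 \<Rightarrow> 'a ell1 \<Rightarrow> real" where
  "dist_ell1 x y = norm (x - y)"
definition sgn_ell1 :: "'a ell1 \<Rightarrow> 'a ell1" where
  "sgn_ell1 x = inverse (norm x) *\<^sub>R x"
definition uniformity_ell1 :: "('a ell1 \<times> 'a ell1) filter" where
  "uniformity_ell1 = (INF e\<in>{0<..}. principal {(x, y). dist x y < e})"
definition open_ell1 :: "'a ell1 set \<Rightarrow> bool" where
  "open_ell1 U \<longleftrightarrow> (\<forall>x\<in>U. \<forall>\<^sub>F (x', y) in uniformity. x' = x \<longrightarrow> y \<in> U)"

instance
proof
  fix x y z :: "'a ell1" and a b :: real
  show "x + y + z = x + (y + z)" "x + y = y + x" "0 + x = x" "- x + x = 0" "x - y = x + - y"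
    by (transfer; simp add: algebra_simps)+
  show "a *\<^sub>R (x + y) = a *\<^sub>R x + a *\<^sub>R y" "(a + b) *\<^sub>R x = a *\<^sub>R x + b *\<^sub>R x"
    "a *\<^sub>R b *\<^sub>R x = (a * b) *\<^sub>R x" "1 *\<^sub>R x = x"
    by (transfer; simp add: algebra_simps)+
  show "norm x = 0 \<longleftrightarrow> x = 0"
    by transfer (auto simp: sum_nonneg_eq_0_iff fun_eq_iff)
  show "norm (x + y) \<le> norm x + norm y"
    by transfer (simp add: sum.distrib[symmetric] sum_mono abs_triangle_ineq)
  show "norm (a *\<^sub>R x) = \<bar>a\<bar> * norm x"
    by transfer (simp add: abs_mult sum_distrib_left)
qed (rule dist_ell1_def sgn_ell1_def uniformity_ell1_def open_ell1_def)+

end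

instantiation ellinf :: (finite) real_normed_vector
begin

lift_definition zero_ellinf :: "'a ellinf" is "\<lambda>i. 0" .
lift_definition plus_ellinf :: "'a ellinf \<Rightarrow> 'a ellinf \<Rightarrow> 'a ellinf" is "\<lambda>x y i. x i + y i" .
lift_definition minus_ellinf :: "'a ellinf \<Rightarrow> 'a ellinf \<Rightarrow> 'a ellinf" is "\<lambda>x y i. x i - y i" .
lift_definition uminus_ellinf :: "'a ellinf \<Rightarrow> 'a ellinf" is "\<lambda>x i. - x i" .
lift_definition scaleR_ellinf :: "real \<Rightarrow> 'a ellinf \<Rightarrow> 'a ellinf" is "\<lambda>r x i. r * x i" .
lift_definition norm_ellinf :: "'a ellinf \<Rightarrow> real" is "\<lambda>x. Max (range (\<lambda>i. \<bar>x i\<bar>))" .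

definition dist_ellinf :: "'a ellinf \<Rightarrow> 'a ellinf \<Rightarrow> real" where
  "dist_ellinf x y = norm (x - y)"
definition sgn_ellinf :: "'a ellinf \<Rightarrow> 'a ellinf" where
  "sgn_ellinf x = inverse (norm x) *\<^sub>R x"
definition uniformity_ellinf :: "('a ellinf \<times> 'a ellinf) filter" where
  "uniformity_ellinf = (INF e\<in>{0<..}. principal {(x, y). dist x y < e})"
definition open_ellinf :: "'a ellinf set \<Rightarrow> bool" where
  "open_ellinf U \<longleftrightarrow> (\<forall>x\<in>U. \<forall>\<^sub>F (x', y) in uniformity. x' = x \<longrightarrow> y \<in> U)"

instance
proof
  fix x y z :: "'a ellinf" and a b :: real
  show "x + y + z = x + (y + z)" "x + y = y + x" "0 + x = x" "- x + x = 0" "x - y = x + - y"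
    by (transfer; simp add: algebra_simps)+
  show "a *\<^sub>R (x + y) = a *\<^sub>R x + a *\<^sub>R y" "(a + b) *\<^sub>R x = a *\<^sub>R x + b *\<^sub>R x"
    "a *\<^sub>R b *\<^sub>R x = (a * b) *\<^sub>R x" "1 *\<^sub>R x = x"
    by (transfer; simp add: algebra_simps)+
  show "norm x = 0 \<longleftrightarrow> x = 0"
  proof (transfer, safe)
    fix x :: "'a \<Rightarrow> real"
    assume 0: "Max (range (\<lambda>i. \<bar>x i\<bar>)) = 0"
    have "\<bar>x i\<bar> \<le> Max (range (\<lambda>i. \<bar>x i\<bar>))" for i by (rule Max_ge) auto
    with 0 show "x = (\<lambda>i. 0)" by (auto simp: fun_eq_iff)
  qed auto
  show "norm (x + y) \<le> norm x + norm y"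
  proof transfer
    fix x y :: "'a \<Rightarrow> real"
    have "\<bar>z i\<bar> \<le> Max (range (\<lambda>i. \<bar>z i\<bar>))" for z :: "'a \<Rightarrow> real" and i by (rule Max_ge) auto
    then have "\<bar>x i + y i\<bar> \<le> Max (range (\<lambda>i. \<bar>x i\<bar>)) + Max (range (\<lambda>i. \<bar>y i\<bar>))" for i
      by (meson abs_triangle_ineq add_mono order_trans)
    then show "Max (range (\<lambda>i. \<bar>x i + y i\<bar>)) \<le> Max (range (\<lambda>i. \<bar>x i\<bar>)) + Max (range (\<lambda>i. \<bar>y i\<bar>))"
      by (subst Max_le_iff) auto
  qed
  show "norm (a *\<^sub>R x) = \<bar>a\<bar> * norm x"
  proof transfer
    fix a :: real and x :: "'a \<Rightarrow> real"
    have "mono (\<lambda>t. \<bar>a\<bar> * t)" by (auto intro!: monoI mult_left_mono)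
    from mono_Max_commute[OF this, of "range (\<lambda>i. \<bar>x i\<bar>)"]
    show "Max (range (\<lambda>i. \<bar>a * x i\<bar>)) = \<bar>a\<bar> * Max (range (\<lambda>i. \<bar>x i\<bar>))"
      by (simp add: image_image abs_mult)
  qed
qed (rule dist_ellinf_def sgn_ellinf_def uniformity_ellinf_def open_ellinf_def)+

end

lemma abs_ell1_nth_le_norm: "\<bar>ell1_nth x i\<bar> \<le> norm x"
  by transfer (rule member_le_sum, auto)

lemma abs_ellinf_nth_le_norm: "\<bar>ellinf_nth x i\<bar> \<le> norm x"
  by transfer (rule Max_ge, auto)

lemma norm_ellinf_le_sum: "norm x \<le> (\<Sum>i\<in>UNIV. \<bar>ellinf_nth x i\<bar>)"
  by transfer (auto intro!: member_le_sum)

instance ell1 :: (finite) banach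
proof
  fix X :: "nat \<Rightarrow> 'a ell1"
  assume X: "Cauchy X"
  have "Cauchy (\<lambda>k. ell1_nth (X k) i)" for i
  proof (rule CauchyI)
    fix e :: real assume "0 < e"
    from CauchyD[OF X this] obtain M where M: "\<And>m n. m \<ge> M \<Longrightarrow> n \<ge> M \<Longrightarrow> norm (X m - X n) < e"
      by blast
    have "norm (ell1_nth (X m) i - ell1_nth (X n) i) \<le> norm (X m - X n)" for m n
      using abs_ell1_nth_le_norm[of "X m - X n" i] by (simp add: minus_ell1.rep_eq)
    with M show "\<exists>M. \<forall>m\<ge>M. \<forall>n\<ge>M. norm (ell1_nth (X m) i - ell1_nth (X n) i) < e"
      by (meson le_less_trans)
  qed
  then have "\<forall>i. \<exists>l. (\<lambda>k. ell1_nth (X k) i) \<longlonglongrightarrow> l"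
    by (simp add: Cauchy_convergent_iff convergent_def)
  then obtain L where L: "\<And>i. (\<lambda>k. ell1_nth (X k) i) \<longlonglongrightarrow> L i" by metis
  have "(\<lambda>k. \<Sum>i\<in>UNIV. \<bar>ell1_nth (X k) i - L i\<bar>) \<longlonglongrightarrow> (\<Sum>i\<in>(UNIV::'a set). \<bar>L i - L i\<bar>)"
    by (intro tendsto_intros L)
  then have "(\<lambda>k. norm (X k - Abs_ell1 L)) \<longlonglongrightarrow> 0"
    by (simp add: norm_ell1.rep_eq minus_ell1.rep_eq Abs_ell1_inverse)
  then have "X \<longlonglongrightarrow> Abs_ell1 L"
    using LIM_zero_cancel tendsto_norm_zero_iff by blast
  then show "convergent X" by (rule convergentI)
qed

instance ellinf :: (finite) banach
proof
  fix X :: "nat \<Rightarrow> 'a ellinf"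
  assume X: "Cauchy X"
  have "Cauchy (\<lambda>k. ellinf_nth (X k) i)" for i
  proof (rule CauchyI)
    fix e :: real assume "0 < e"
    from CauchyD[OF X this] obtain M where M: "\<And>m n. m \<ge> M \<Longrightarrow> n \<ge> M \<Longrightarrow> norm (X m - X n) < e"
      by blast
    have "norm (ellinf_nth (X m) i - ellinf_nth (X n) i) \<le> norm (X m - X n)" for m n
      using abs_ellinf_nth_le_norm[of "X m - X n" i] by (simp add: minus_ellinf.rep_eq)
    with M show "\<exists>M. \<forall>m\<ge>M. \<forall>n\<ge>M. norm (ellinf_nth (X m) i - ellinf_nth (X n) i) < e"
      by (meson le_less_trans)
  qed
  then have "\<forall>i. \<exists>l. (\<lambda>k. ellinf_nth (X k) i) \<longlonglongrightarrow> l"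
    by (simp add: Cauchy_convergent_iff convergent_def)
  then obtain L where L: "\<And>i. (\<lambda>k. ellinf_nth (X k) i) \<longlonglongrightarrow> L i" by metis
  have "(\<lambda>k. \<Sum>i\<in>UNIV. \<bar>ellinf_nth (X k) i - L i\<bar>) \<longlonglongrightarrow> (\<Sum>i\<in>(UNIV::'a set). \<bar>L i - L i\<bar>)"
    by (intro tendsto_intros L)
  then have "(\<lambda>k. \<Sum>i\<in>UNIV. \<bar>ellinf_nth (X k - Abs_ellinf L) i\<bar>) \<longlonglongrightarrow> 0"
    by (simp add: minus_ellinf.rep_eq Abs_ellinf_inverse)
  then have "(\<lambda>k. norm (X k - Abs_ellinf L)) \<longlonglongrightarrow> 0"
    by (rule tendsto_sandwich[OF _ _ tendsto_const, rotated 2])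
       (auto intro!: always_eventually norm_ellinf_le_sum)
  then have "X \<longlonglongrightarrow> Abs_ellinf L"
    using LIM_zero_cancel tendsto_norm_zero_iff by blast
  then show "convergent X" by (rule convergentI)
qed

instance ell1 :: (finite) finite_dim_normed
proof
  let ?b = "\<lambda>i. Abs_ell1 (\<lambda>j. if j = i then 1 else 0) :: 'a ell1"
  have inj: "inj ?b"
    by (rule injI) (auto simp: Abs_ell1_inject fun_eq_iff split: if_splits)
  have nth_sum: "ell1_nth (\<Sum>i\<in>A. f i) j = (\<Sum>i\<in>A. ell1_nth (f i) j)"
    for A :: "'a set" and f :: "'a \<Rightarrow> 'a ell1" and j
    by (induction A rule: infinite_finite_induct) (auto simp: zero_ell1.rep_eq plus_ell1.rep_eq)
  have "x = (\<Sum>b\<in>range ?b. ell1_nth x (inv ?b b) *\<^sub>R b)" for x :: "'a ell1"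
  proof -
    have "x = (\<Sum>i\<in>UNIV. ell1_nth x i *\<^sub>R ?b i)"
      by (rule ell1_nth_inject[THEN iffD1], rule ext)
         (simp add: nth_sum scaleR_ell1.rep_eq Abs_ell1_inverse if_distrib cong: if_cong)
    also have "\<dots> = (\<Sum>b\<in>range ?b. ell1_nth x (inv ?b b) *\<^sub>R b)"
      by (simp add: sum.reindex[OF inj] inv_f_f[OF inj])
    finally show ?thesis .
  qed
  then show "\<exists>B::'a ell1 set. finite B \<and> (\<forall>x. \<exists>c. x = (\<Sum>b\<in>B. c b *\<^sub>R b))"
    by (meson finite finite_imageI)
qed

section \<open>Injective and projective tensor norms\<close>

text \<open>The algebraic tensor product \<open>E \<otimes> F\<close> is realised inside the dual of the space of bounded
  bilinear forms \<open>B : E \<times> F \<rightarrow> \<real>\<close> (in curried form), with \<open>x \<otimes> y\<close> the evaluation \<open>B \<mapsto> B x y\<close>.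
  Bounded bilinear forms separate the points of \<open>E \<otimes> F\<close>, so nothing is identified that
  is distinct in \<open>E \<otimes> F\<close>.  If \<open>E\<close> is finite-dimensional and \<open>F\<close> is a Banach space, then \<open>E \<otimes> F\<close> is
  complete in the injective and in the projective norm, so that no completion has to be taken.\<close>

lift_definition tensor ::
  "'a::real_normed_vector \<Rightarrow> 'b::real_normed_vector \<Rightarrow> ('a \<Rightarrow>\<^sub>L 'b \<Rightarrow>\<^sub>L real) \<Rightarrow>\<^sub>L real"
  is "\<lambda>(x::'a) (y::'b) (B::'a \<Rightarrow>\<^sub>L 'b \<Rightarrow>\<^sub>L real). blinfun_apply (blinfun_apply B x) y"
  by (intro bounded_linear_intros)

definition tensor_product ::
  "(('a::real_normed_vector \<Rightarrow>\<^sub>L 'b::real_normed_vector \<Rightarrow>\<^sub>L real) \<Rightarrow>\<^sub>L real) set" where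
  "tensor_product = span {tensor x y | x y. True}"

text \<open>\<open>x \<mapsto> \<phi>(x) y\<close>, the operator identified with \<open>\<phi> \<otimes> y\<close>; for real functionals \<open>\<phi>\<close> and \<open>\<psi>\<close>,
  \<open>rank_one \<phi> \<psi>\<close> is the bilinear form \<open>(x, y) \<mapsto> \<phi>(x) \<psi>(y)\<close>.\<close>

lift_definition rank_one ::
  "('a::real_normed_vector \<Rightarrow>\<^sub>L real) \<Rightarrow> 'b::real_normed_vector \<Rightarrow> 'a \<Rightarrow>\<^sub>L 'b"
  is "\<lambda>(\<phi>::'a \<Rightarrow>\<^sub>L real) (y::'b) x. blinfun_apply \<phi> x *\<^sub>R y"
  by (intro bounded_linear_intros)

definition injective_norm ::
  "(('a::real_normed_vector \<Rightarrow>\<^sub>L 'b::real_normed_vector \<Rightarrow>\<^sub>L real) \<Rightarrow>\<^sub>L real) \<Rightarrow> real" where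
  "injective_norm u =
     Sup {\<bar>blinfun_apply u (rank_one \<phi> \<psi>)\<bar> | \<phi> \<psi>. norm \<phi> \<le> 1 \<and> norm \<psi> \<le> 1}"

definition projective_norm ::
  "(('a::real_normed_vector \<Rightarrow>\<^sub>L 'b::real_normed_vector \<Rightarrow>\<^sub>L real) \<Rightarrow>\<^sub>L real) \<Rightarrow> real" where
  "projective_norm u =
     Inf {(\<Sum>(x, y)\<leftarrow>zs. norm x * norm y) | zs. u = (\<Sum>(x, y)\<leftarrow>zs. tensor x y)}"

text \<open>\<open>A \<otimes> id\<close>: evaluating \<open>(A \<otimes> id) u\<close> at a bilinear form \<open>B\<close> means evaluating \<open>u\<close>
  at \<open>(x, y) \<mapsto> B (A x) y\<close>; cf. \<open>tensor_map_id_tensor\<close>.\<close>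

lift_definition tensor_map_id ::
  "('a::real_normed_vector \<Rightarrow>\<^sub>L 'c::real_normed_vector) \<Rightarrow>
   (('a \<Rightarrow>\<^sub>L 'b::real_normed_vector \<Rightarrow>\<^sub>L real) \<Rightarrow>\<^sub>L real) \<Rightarrow> (('c \<Rightarrow>\<^sub>L 'b \<Rightarrow>\<^sub>L real) \<Rightarrow>\<^sub>L real)"
  is "\<lambda>(A::'a \<Rightarrow>\<^sub>L 'c) (u::('a \<Rightarrow>\<^sub>L 'b \<Rightarrow>\<^sub>L real) \<Rightarrow>\<^sub>L real) (B::'c \<Rightarrow>\<^sub>L 'b \<Rightarrow>\<^sub>L real).
        blinfun_apply u (B o\<^sub>L A)"
  by (intro bounded_linear_intros)

lemma tensor_map_id_tensor: "tensor_map_id A (tensor x y) = tensor (blinfun_apply A x) y"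
  by (rule blinfun_eqI) (simp add: tensor_map_id.rep_eq tensor.rep_eq)

text \<open>Operator norms of maps \<open>A \<otimes> id\<close> and the constants below are suprema in the extended reals, so
  that no boundedness has to be established before they are meaningful.\<close>

definition injective_projective_onorm ::
  "((('a::real_normed_vector \<Rightarrow>\<^sub>L 'b::real_normed_vector \<Rightarrow>\<^sub>L real) \<Rightarrow>\<^sub>L real) \<Rightarrow>
    (('c::real_normed_vector \<Rightarrow>\<^sub>L 'd::real_normed_vector \<Rightarrow>\<^sub>L real) \<Rightarrow>\<^sub>L real)) \<Rightarrow> ereal" where
  "injective_projective_onorm T =
     (SUP u\<in>{u \<in> tensor_product. injective_norm u \<le> 1}. ereal (projective_norm (T u)))"

section \<open>The constants\<close>

definition positive_map :: "('a::real_normed_vector \<Rightarrow>\<^sub>L 'a \<Rightarrow>\<^sub>L real) \<Rightarrow> bool" where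
  "positive_map A \<longleftrightarrow> A \<in> convex hull {rank_one \<phi> \<phi> | \<phi>. True}"

definition KG_plus :: "'e::finite_dim_normed itself \<Rightarrow> 'f::banach itself \<Rightarrow> ereal" where
  "KG_plus _ _ =
     (SUP A\<in>{A :: 'e \<Rightarrow>\<^sub>L 'e \<Rightarrow>\<^sub>L real. positive_map A \<and> norm A \<le> 1}.
        injective_projective_onorm
          (tensor_map_id A :: (('e \<Rightarrow>\<^sub>L 'f \<Rightarrow>\<^sub>L real) \<Rightarrow>\<^sub>L real) \<Rightarrow> _))"

definition ell2_inner :: "(nat \<Rightarrow> real) \<Rightarrow> (nat \<Rightarrow> real) \<Rightarrow> real" where
  "ell2_inner v w = (\<Sum>k. v k * w k)"

definition ell2_unit :: "(nat \<Rightarrow> real) \<Rightarrow> bool" where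
  "ell2_unit v \<longleftrightarrow> summable (\<lambda>k. (v k)\<^sup>2) \<and> sqrt (ell2_inner v v) = 1"

definition matrix_sup_norm :: "nat \<Rightarrow> nat \<Rightarrow> (nat \<Rightarrow> nat \<Rightarrow> real) \<Rightarrow> ereal" where
  "matrix_sup_norm m n a =
     Sup {ereal \<bar>\<Sum>i<m. \<Sum>j<n. a i j * s i * t j\<bar> | s t.
            (\<forall>i<m. \<bar>s i\<bar> \<le> 1) \<and> (\<forall>j<n. \<bar>t j\<bar> \<le> 1)}"

definition grothendieck_constant :: ereal where
  "grothendieck_constant =
     Sup {ereal \<bar>\<Sum>i<m. \<Sum>j<n. a i j * ell2_inner (v i) (w j)\<bar> | m n a v w.
            matrix_sup_norm m n a \<le> 1 \<and>
            (\<forall>i<m. ell2_unit (v i)) \<and> (\<forall>j<n. ell2_unit (w j))}"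

end

theory Submission
  imports Defs
begin

text \<open>In coordinates, all the tensor norms that occur are explicit norms on matrices.  The spaces
  \<open>\<ell>\<^sub>1 \<otimes> \<ell>\<^sub>1\<close> (injective) and \<open>\<ell>\<^sub>\<infinity> \<otimes> \<ell>\<^sub>\<infinity>\<close> (projective) are dual to each other under the trace
  pairing of matrices, and so are \<open>\<ell>\<^sub>1 \<otimes> \<ell>\<^sub>\<infinity>\<close> (injective) and \<open>\<ell>\<^sub>\<infinity> \<otimes> \<ell>\<^sub>1\<close> (projective).
  If \<open>a\<close> is the matrix of \<open>A\<close>, then \<open>A \<otimes> id\<close> is left multiplication by \<open>a\<close>.  Since \<open>a\<close> is symmetric,
  the two operators \<open>A \<otimes> id\<close> with \<open>F = \<ell>\<^sub>1\<close> and with \<open>F = \<ell>\<^sub>\<infinity>\<close> are therefore adjoint to each other and have the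
  same norm, already for each single \<open>A\<close>.  The common value of the two constants is the supremum
  \<open>gram_constant\<close> of \<open>\<Sum>\<^sub>j max\<^sub>i \<bar>(a M)\<^sub>i\<^sub>j\<bar>\<close> over all admissible \<open>a\<close> and all \<open>M\<close> of norm at most 1 as
  bilinear forms on \<open>\<ell>\<^sub>\<infinity> \<times> \<ell>\<^sub>\<infinity>\<close>; see \<open>KG_plus_ell1_ell1\<close> and \<open>KG_plus_ell1_ellinf\<close>.

  Symmetry is only part of positivity; the comparison with the Grothendieck constant uses all of it.  A positive \<open>A\<close> has a Gram
  matrix \<open>a\<^sub>i\<^sub>k = \<langle>x\<^sub>i, x\<^sub>k\<rangle>\<close>, and \<open>\<parallel>A\<parallel> \<le> 1\<close> gives \<open>\<parallel>x\<^sub>i\<parallel>\<^sup>2 = a\<^sub>i\<^sub>i \<le> 1\<close>.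
  If the maximum in column \<open>j\<close> is attained in row \<open>f(j)\<close>, with sign \<open>e\<^sub>j\<close>, then
  \<open>\<Sum>\<^sub>j max\<^sub>i \<bar>(a M)\<^sub>i\<^sub>j\<bar> = \<Sum>\<^sub>k\<^sub>j M\<^sub>k\<^sub>j \<langle>x\<^sub>k, y\<^sub>j\<rangle>\<close> with \<open>y\<^sub>j = e\<^sub>j x\<^bsub>f(j)\<^esub>\<close>, which is a sum as in the definition of
  the Grothendieck constant except that the vectors lie in the unit ball; two further coordinates make
  them unit vectors without changing the inner products.\<close>

section \<open>Matrix norms in duality\<close>

text \<open>The unit ball of the bilinear forms on \<open>\<ell>\<^sub>\<infinity> \<times> \<ell>\<^sub>\<infinity>\<close>, which is that of the injective tensor
  product \<open>\<ell>\<^sub>1 \<otimes> \<ell>\<^sub>1\<close>.\<close>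

definition form_bounded :: "('n::finite \<Rightarrow> 'n \<Rightarrow> real) \<Rightarrow> bool" where
  "form_bounded M \<longleftrightarrow> (\<forall>s t. (\<forall>i. \<bar>s i\<bar> \<le> 1) \<longrightarrow> (\<forall>j. \<bar>t j\<bar> \<le> 1) \<longrightarrow>
     \<bar>\<Sum>i\<in>UNIV. \<Sum>j\<in>UNIV. M i j * s i * t j\<bar> \<le> 1)"

text \<open>The unit ball of \<open>\<ell>\<^sub>\<infinity>(\<ell>\<^sub>1)\<close>, which is the injective tensor product \<open>\<ell>\<^sub>1 \<otimes> \<ell>\<^sub>\<infinity>\<close>.\<close>

definition columns_bounded :: "('n::finite \<Rightarrow> 'n \<Rightarrow> real) \<Rightarrow> bool" where
  "columns_bounded M \<longleftrightarrow> (\<forall>j. (\<Sum>i\<in>UNIV. \<bar>M i j\<bar>) \<le> 1)"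

text \<open>The norm of \<open>\<ell>\<^sub>1(\<ell>\<^sub>\<infinity>)\<close>, which is the projective tensor product \<open>\<ell>\<^sub>\<infinity> \<otimes> \<ell>\<^sub>1\<close>.\<close>

definition column_max_sum :: "('n::finite \<Rightarrow> 'n \<Rightarrow> real) \<Rightarrow> real" where
  "column_max_sum M = (\<Sum>j\<in>UNIV. Max (range (\<lambda>i. \<bar>M i j\<bar>)))"

definition pairing :: "('n::finite \<Rightarrow> 'n \<Rightarrow> real) \<Rightarrow> ('n \<Rightarrow> 'n \<Rightarrow> real) \<Rightarrow> real" where
  "pairing L M = (\<Sum>i\<in>UNIV. \<Sum>j\<in>UNIV. L i j * M i j)"

definition mat_mult :: "('n::finite \<Rightarrow> 'n \<Rightarrow> real) \<Rightarrow> ('n \<Rightarrow> 'n \<Rightarrow> real) \<Rightarrow> 'n \<Rightarrow> 'n \<Rightarrow> real" where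
  "mat_mult a M = (\<lambda>i j. \<Sum>k\<in>UNIV. a i k * M k j)"

text \<open>Multiplication by a symmetric matrix is self-adjoint for the trace pairing.  This is
  why the constants for \<open>F = \<ell>\<^sub>1\<close> and \<open>F = \<ell>\<^sub>\<infinity>\<close> agree.\<close>

lemma pairing_mat_mult:
  assumes "\<And>i k. a i k = a k i"
  shows "pairing L (mat_mult a M) = pairing M (mat_mult a L)"
proof -
  have "pairing L (mat_mult a M) = (\<Sum>j\<in>UNIV. \<Sum>i\<in>UNIV. \<Sum>k\<in>UNIV. a i k * L i j * M k j)"
    unfolding pairing_def mat_mult_def
    by (subst sum.swap) (simp add: sum_distrib_left mult_ac)
  also have "\<dots> = (\<Sum>j\<in>UNIV. \<Sum>k\<in>UNIV. \<Sum>i\<in>UNIV. a i k * L i j * M k j)"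
    by (intro sum.cong refl sum.swap)
  also have "\<dots> = (\<Sum>k\<in>UNIV. \<Sum>j\<in>UNIV. \<Sum>i\<in>UNIV. a i k * L i j * M k j)"
    by (rule sum.swap)
  also have "\<dots> = pairing M (mat_mult a L)"
  proof -
    have "(\<Sum>i\<in>UNIV. a i k * L i j * M k j) = M k j * mat_mult a L k j" for k j
      unfolding mat_mult_def sum_distrib_left
      by (intro sum.cong refl) (simp add: assms[of k] mult_ac)
    then show ?thesis by (simp add: pairing_def)
  qed
  finally show ?thesis .
qed

lemma pairing_le_column_max_sum:
  assumes "columns_bounded U"
  shows "pairing U M \<le> column_max_sum M"
proof -
  have "(\<Sum>i\<in>UNIV. U i j * M i j) \<le> Max (range (\<lambda>i. \<bar>M i j\<bar>))" for j
  proof -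
    let ?m = "Max (range (\<lambda>i. \<bar>M i j\<bar>))"
    have m: "\<bar>M i j\<bar> \<le> ?m" for i by (rule Max_ge) auto
    have "(\<Sum>i\<in>UNIV. U i j * M i j) \<le> (\<Sum>i\<in>UNIV. \<bar>U i j\<bar> * ?m)"
    proof (rule sum_mono)
      fix i
      have "U i j * M i j \<le> \<bar>U i j\<bar> * \<bar>M i j\<bar>" by (metis abs_ge_self abs_mult)
      also have "\<dots> \<le> \<bar>U i j\<bar> * ?m" using m by (intro mult_left_mono) auto
      finally show "U i j * M i j \<le> \<bar>U i j\<bar> * ?m" .
    qed
    also have "\<dots> = (\<Sum>i\<in>UNIV. \<bar>U i j\<bar>) * ?m" by (simp add: sum_distrib_right)
    also have "\<dots> \<le> 1 * ?m"
      using assms order_trans[OF abs_ge_zero m] by (intro mult_right_mono) (auto simp: columns_bounded_def)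
    finally show ?thesis by simp
  qed
  then show ?thesis
    unfolding pairing_def column_max_sum_def by (subst sum.swap) (intro sum_mono)
qed

text \<open>Here \<open>f\<close> selects in each column an entry of largest modulus, and \<open>e\<close> is its sign.\<close>

lemma column_max_sum_attained:
  obtains f :: "'n::finite \<Rightarrow> 'n" and e :: "'n \<Rightarrow> real"
  where "\<And>j. \<bar>e j\<bar> \<le> 1" "column_max_sum M = (\<Sum>j\<in>UNIV. e j * M (f j) j)"
proof -
  have "\<exists>i. Max (range (\<lambda>i. \<bar>M i j\<bar>)) = \<bar>M i j\<bar>" for j
  proof -
    have "Max (range (\<lambda>i. \<bar>M i j\<bar>)) \<in> range (\<lambda>i. \<bar>M i j\<bar>)" by (rule Max_in) auto
    then show ?thesis unfolding image_iff by blast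
  qed
  then obtain f where f: "\<And>j. Max (range (\<lambda>i. \<bar>M i j\<bar>)) = \<bar>M (f j) j\<bar>" by metis
  show ?thesis
  proof (rule that[of "\<lambda>j. sgn (M (f j) j)" f])
    show "column_max_sum M = (\<Sum>j\<in>UNIV. sgn (M (f j) j) * M (f j) j)"
      unfolding column_max_sum_def f by (simp add: abs_sgn mult.commute)
  qed (simp add: abs_sgn_eq)
qed

text \<open>Together with \<open>pairing_le_column_max_sum\<close>, this is the duality of \<open>\<ell>\<^sub>1(\<ell>\<^sub>\<infinity>)\<close> and
  \<open>\<ell>\<^sub>\<infinity>(\<ell>\<^sub>1)\<close>: a norming element has a single signed entry in each column, at the place of the maximum.\<close>

lemma column_max_sum_eq_pairing:
  obtains U :: "'n::finite \<Rightarrow> 'n \<Rightarrow> real"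
  where "columns_bounded U" "column_max_sum M = pairing U M"
proof -
  obtain f :: "'n \<Rightarrow> 'n" and e where e: "\<And>j. \<bar>e j\<bar> \<le> 1"
    and *: "column_max_sum M = (\<Sum>j\<in>UNIV. e j * M (f j) j)"
    using column_max_sum_attained[of M] by metis
  show ?thesis
  proof (rule that[of "\<lambda>i j. if i = f j then e j else 0"])
    show "columns_bounded (\<lambda>i j. if i = f j then e j else 0)"
      using e by (simp add: columns_bounded_def if_distrib[of abs] cong: if_cong)
    show "column_max_sum M = pairing (\<lambda>i j. if i = f j then e j else 0) M"
      unfolding pairing_def * by (subst sum.swap) (simp add: if_distrib[of "\<lambda>x. x * _"] cong: if_cong)
  qed
qed

section \<open>Coordinates in the sequence spaces and their duals\<close>

definition ell1_basis :: "'n::finite \<Rightarrow> 'n ell1" where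
  "ell1_basis i = Abs_ell1 (\<lambda>k. if k = i then 1 else 0)"

definition ellinf_basis :: "'n::finite \<Rightarrow> 'n ellinf" where
  "ellinf_basis i = Abs_ellinf (\<lambda>k. if k = i then 1 else 0)"

lift_definition ell1_coord :: "'n::finite \<Rightarrow> 'n ell1 \<Rightarrow>\<^sub>L real" is "\<lambda>i x. ell1_nth x i"
  by (rule bounded_linear_intro[where K = 1])
     (simp_all add: plus_ell1.rep_eq scaleR_ell1.rep_eq abs_ell1_nth_le_norm)

lift_definition ellinf_coord :: "'n::finite \<Rightarrow> 'n ellinf \<Rightarrow>\<^sub>L real" is "\<lambda>i x. ellinf_nth x i"
  by (rule bounded_linear_intro[where K = 1])
     (simp_all add: plus_ellinf.rep_eq scaleR_ellinf.rep_eq abs_ellinf_nth_le_norm)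

lemma ell1_coord_basis: "ell1_coord i (ell1_basis j) = (if i = j then 1 else 0)"
  by (simp add: ell1_coord.rep_eq ell1_basis_def Abs_ell1_inverse)

lemma ellinf_coord_basis: "ellinf_coord i (ellinf_basis j) = (if i = j then 1 else 0)"
  by (simp add: ellinf_coord.rep_eq ellinf_basis_def Abs_ellinf_inverse)

lemma ell1_nth_sum: "ell1_nth (\<Sum>i\<in>I. x i) j = (\<Sum>i\<in>I. ell1_nth (x i) j)"
  by (induction I rule: infinite_finite_induct) (auto simp: zero_ell1.rep_eq plus_ell1.rep_eq)

lemma ellinf_nth_sum: "ellinf_nth (\<Sum>i\<in>I. x i) j = (\<Sum>i\<in>I. ellinf_nth (x i) j)"
  by (induction I rule: infinite_finite_induct) (auto simp: zero_ellinf.rep_eq plus_ellinf.rep_eq)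

lemma ell1_expansion: "(\<Sum>i\<in>UNIV. ell1_coord i x *\<^sub>R ell1_basis i) = x"
  by (rule ell1_nth_inject[THEN iffD1], rule ext)
     (simp add: ell1_nth_sum scaleR_ell1.rep_eq ell1_coord.rep_eq ell1_basis_def Abs_ell1_inverse
       if_distrib cong: if_cong)

lemma ellinf_expansion: "(\<Sum>i\<in>UNIV. ellinf_coord i x *\<^sub>R ellinf_basis i) = x"
  by (rule ellinf_nth_inject[THEN iffD1], rule ext)
     (simp add: ellinf_nth_sum scaleR_ellinf.rep_eq ellinf_coord.rep_eq ellinf_basis_def
       Abs_ellinf_inverse if_distrib cong: if_cong)

lemma norm_ell1_coords: "norm x = (\<Sum>i\<in>UNIV. \<bar>ell1_coord i x\<bar>)"
  by (simp add: norm_ell1.rep_eq ell1_coord.rep_eq)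

lemma norm_ell1_basis: "norm (ell1_basis i) = 1"
  by (simp add: norm_ell1_coords ell1_coord_basis if_distrib[of abs] cong: if_cong)

lemma abs_ellinf_coord_le: "\<bar>ellinf_coord i x\<bar> \<le> norm x"
  by (simp add: ellinf_coord.rep_eq abs_ellinf_nth_le_norm)

lemma ellinf_coord_sum: "ellinf_coord i (\<Sum>j\<in>UNIV. t j *\<^sub>R ellinf_basis j) = t i"
  by (simp add: blinfun.sum_right blinfun.scaleR_right ellinf_coord_basis if_distrib cong: if_cong)

lemma norm_ellinf_sum_le:
  fixes t :: "'n::finite \<Rightarrow> real"
  assumes "\<And>j. \<bar>t j\<bar> \<le> 1"
  shows "norm (\<Sum>j\<in>UNIV. t j *\<^sub>R ellinf_basis j) \<le> 1"
proof -
  have "ellinf_nth (\<Sum>j\<in>UNIV. t j *\<^sub>R ellinf_basis j) i = t i" for i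
    using ellinf_coord_sum[of i t] by (simp add: ellinf_coord.rep_eq)
  then show ?thesis
    using assms by (simp add: norm_ellinf.rep_eq)
qed

lemma ell1_functional_expansion:
  "(\<Sum>i\<in>UNIV. blinfun_apply \<phi> (ell1_basis i) *\<^sub>R ell1_coord i) = (\<phi> :: 'n::finite ell1 \<Rightarrow>\<^sub>L real)"
proof (rule blinfun_eqI)
  fix x :: "'n ell1"
  have "\<phi> x = \<phi> (\<Sum>i\<in>UNIV. ell1_coord i x *\<^sub>R ell1_basis i)" by (simp add: ell1_expansion)
  then show "(\<Sum>i\<in>UNIV. \<phi> (ell1_basis i) *\<^sub>R ell1_coord i) x = \<phi> x"
    by (simp add: blinfun.sum_left blinfun.scaleR_left blinfun.sum_right blinfun.scaleR_right
        mult.commute)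
qed

lemma ell1_functional_basis_le: "\<bar>blinfun_apply \<phi> (ell1_basis i)\<bar> \<le> norm \<phi>"
  using norm_blinfun[of \<phi> "ell1_basis i"] by (simp add: norm_ell1_basis)

lemma norm_ell1_functional_le:
  fixes s :: "'n::finite \<Rightarrow> real"
  assumes "\<And>i. \<bar>s i\<bar> \<le> K"
  shows "norm (\<Sum>i\<in>UNIV. s i *\<^sub>R ell1_coord i) \<le> K"
proof (rule norm_blinfun_bound)
  show "0 \<le> K" using assms[of undefined] by linarith
  fix x :: "'n ell1"
  have "\<bar>\<Sum>i\<in>UNIV. s i * ell1_coord i x\<bar> \<le> (\<Sum>i\<in>UNIV. K * \<bar>ell1_coord i x\<bar>)"
    by (rule order_trans[OF sum_abs]) (auto intro!: sum_mono mult_right_mono assms simp: abs_mult)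
  then show "norm ((\<Sum>i\<in>UNIV. s i *\<^sub>R ell1_coord i) x) \<le> K * norm x"
    by (simp add: blinfun.sum_left blinfun.scaleR_left norm_ell1_coords sum_distrib_left)
qed

lemma ell1_functional_basis_sum:
  "(\<Sum>k\<in>UNIV. s k *\<^sub>R ell1_coord k) (ell1_basis i) = s i"
  by (simp add: blinfun.sum_left blinfun.scaleR_left ell1_coord_basis if_distrib cong: if_cong)

text \<open>The easy half of \<open>(\<ell>\<^sub>\<infinity>)\<^sup>* = \<ell>\<^sub>1\<close>: test \<open>\<psi>\<close> on the vector of signs of its coefficients.\<close>

lemma sum_abs_ellinf_functional_le:
  fixes \<psi> :: "'n::finite ellinf \<Rightarrow>\<^sub>L real"
  shows "(\<Sum>j\<in>UNIV. \<bar>blinfun_apply \<psi> (ellinf_basis j)\<bar>) \<le> norm \<psi>"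
proof -
  let ?y = "\<Sum>j\<in>UNIV. sgn (\<psi> (ellinf_basis j)) *\<^sub>R ellinf_basis j"
  have "(\<Sum>j\<in>UNIV. \<bar>\<psi> (ellinf_basis j)\<bar>) = \<psi> ?y"
    by (simp add: blinfun.sum_right blinfun.scaleR_right abs_sgn mult.commute)
  also have "\<dots> \<le> norm \<psi> * norm ?y"
    using norm_blinfun[of \<psi> ?y] by simp
  also have "\<dots> \<le> norm \<psi> * 1"
    by (intro mult_left_mono norm_ellinf_sum_le) (auto simp: abs_sgn_eq)
  finally show ?thesis by simp
qed

section \<open>Tensors and matrices\<close>

lemma rank_one_apply: "rank_one \<phi> \<psi> x y = \<phi> x * \<psi> y" for \<psi> :: "'b::real_normed_vector \<Rightarrow>\<^sub>L real"
  by (simp add: rank_one.rep_eq blinfun.scaleR_left)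

lemma norm_rank_one_le: "norm (rank_one \<phi> y) \<le> norm \<phi> * norm y"
proof (rule norm_blinfun_bound)
  fix x
  have "norm (\<phi> x) * norm y \<le> (norm \<phi> * norm x) * norm y"
    by (intro mult_right_mono norm_blinfun) auto
  then show "norm (rank_one \<phi> y x) \<le> norm \<phi> * norm y * norm x"
    by (simp add: rank_one.rep_eq mult_ac)
qed simp

lemma injective_norm_le_1_iff:
  "injective_norm u \<le> 1 \<longleftrightarrow>
     (\<forall>\<phi> \<psi>. norm \<phi> \<le> 1 \<longrightarrow> norm \<psi> \<le> 1 \<longrightarrow> \<bar>blinfun_apply u (rank_one \<phi> \<psi>)\<bar> \<le> 1)"
proof -
  let ?S = "{\<bar>blinfun_apply u (rank_one \<phi> \<psi>)\<bar> | \<phi> \<psi>. norm \<phi> \<le> 1 \<and> norm \<psi> \<le> 1}"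
  have "\<bar>u (rank_one 0 0)\<bar> \<in> ?S"
    by (rule CollectI, rule exI[of _ 0], rule exI[of _ 0]) simp
  then have "?S \<noteq> {}" by blast
  moreover have "bdd_above ?S"
  proof (rule bdd_aboveI[where M = "norm u"], safe)
    fix \<phi> :: "'a \<Rightarrow>\<^sub>L real" and \<psi> :: "'b \<Rightarrow>\<^sub>L real"
    assume *: "norm \<phi> \<le> 1" "norm \<psi> \<le> 1"
    have "norm (u (rank_one \<phi> \<psi>)) \<le> norm u * norm (rank_one \<phi> \<psi>)" by (rule norm_blinfun)
    also have "\<dots> \<le> norm u * (norm \<phi> * norm \<psi>)"
      by (intro mult_left_mono norm_rank_one_le) auto
    also have "\<dots> \<le> norm u * 1"
      using * by (intro mult_left_mono mult_le_one) auto
    finally show "\<bar>u (rank_one \<phi> \<psi>)\<bar> \<le> norm u" by simp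
  qed
  ultimately show ?thesis
    unfolding injective_norm_def by (subst cSup_le_iff) blast+
qed

lemma projective_norm_le:
  assumes "finite I" "u = (\<Sum>i\<in>I. tensor (x i) (y i))"
  shows "projective_norm u \<le> (\<Sum>i\<in>I. norm (x i) * norm (y i))"
proof -
  obtain ks where ks: "set ks = I" "distinct ks"
    using finite_distinct_list[OF assms(1)] by blast
  show ?thesis
    unfolding projective_norm_def
  proof (rule cInf_lower)
    show "bdd_below {(\<Sum>(x, y)\<leftarrow>zs. norm x * norm y) | zs. u = (\<Sum>(x, y)\<leftarrow>zs. tensor x y)}"
      by (rule bdd_belowI[where m = 0]) (auto intro!: sum_list_nonneg)
    show "(\<Sum>i\<in>I. norm (x i) * norm (y i))
        \<in> {(\<Sum>(x, y)\<leftarrow>zs. norm x * norm y) | zs. u = (\<Sum>(x, y)\<leftarrow>zs. tensor x y)}"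
      using ks assms(2)
      by (intro CollectI exI[of _ "map (\<lambda>i. (x i, y i)) ks"])
         (auto simp: o_def sum_list_distinct_conv_sum_set)
  qed
qed

text \<open>Bilinear forms in the unit ball give the lower bounds for projective norms.  Membership in the
  algebraic tensor product is essential: without any representation of \<open>u\<close> as a finite sum, the infimum
  would be taken over the empty set.\<close>

lemma apply_le_projective_norm:
  assumes u: "u \<in> tensor_product" and D: "\<And>x y. \<bar>blinfun_apply (blinfun_apply D x) y\<bar> \<le> norm x * norm y"
  shows "blinfun_apply u D \<le> projective_norm u"
  unfolding projective_norm_def
proof (rule cInf_greatest)
  have "\<exists>zs. u = (\<Sum>(x, y)\<leftarrow>zs. tensor x y)"
    using u unfolding tensor_product_def
  proof (induction rule: span_induct_alt)
    case base
    show ?case by (rule exI[of _ "[]"]) simp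
  next
    case (step c t v)
    then obtain x y zs where "t = tensor x y" "v = (\<Sum>(x, y)\<leftarrow>zs. tensor x y)" by blast
    moreover have "c *\<^sub>R tensor x y = tensor (c *\<^sub>R x) y"
      by (rule blinfun_eqI)
         (simp add: tensor.rep_eq blinfun.scaleR_left blinfun.scaleR_right)
    ultimately show ?case by (intro exI[of _ "(c *\<^sub>R x, y) # zs"]) simp
  qed
  then show "{(\<Sum>(x, y)\<leftarrow>zs. norm x * norm y) | zs. u = (\<Sum>(x, y)\<leftarrow>zs. tensor x y)} \<noteq> {}"
    by blast
  fix r assume "r \<in> {(\<Sum>(x, y)\<leftarrow>zs. norm x * norm y) | zs. u = (\<Sum>(x, y)\<leftarrow>zs. tensor x y)}"
  then obtain zs where r: "r = (\<Sum>(x, y)\<leftarrow>zs. norm x * norm y)"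
    and u: "u = (\<Sum>(x, y)\<leftarrow>zs. tensor x y)" by blast
  have "blinfun_apply (\<Sum>(x, y)\<leftarrow>zs. tensor x y) D \<le> (\<Sum>(x, y)\<leftarrow>zs. norm x * norm y)"
  proof (induction zs)
    case (Cons z zs)
    obtain x y where "z = (x, y)" by force
    with Cons D[of x y] show ?case
      by (simp add: blinfun.add_left tensor.rep_eq)
  qed simp
  then show "blinfun_apply u D \<le> r" by (simp add: u r)
qed

definition matrix_tensor ::
  "('n::finite \<Rightarrow> 'a::real_normed_vector) \<Rightarrow> ('n \<Rightarrow> 'b::real_normed_vector) \<Rightarrow> ('n \<Rightarrow> 'n \<Rightarrow> real) \<Rightarrow>
   ('a \<Rightarrow>\<^sub>L 'b \<Rightarrow>\<^sub>L real) \<Rightarrow>\<^sub>L real" where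
  "matrix_tensor x y M = (\<Sum>i\<in>UNIV. \<Sum>j\<in>UNIV. M i j *\<^sub>R tensor (x i) (y j))"

lemma matrix_tensor_apply:
  "blinfun_apply (matrix_tensor x y M) D = (\<Sum>i\<in>UNIV. \<Sum>j\<in>UNIV. M i j * D (x i) (y j))"
  by (simp add: matrix_tensor_def blinfun.sum_left blinfun.scaleR_left tensor.rep_eq)

lemma matrix_tensor_in_tensor_product: "matrix_tensor x y M \<in> tensor_product"
  unfolding matrix_tensor_def tensor_product_def
  by (intro span_sum span_scale span_base) blast

text \<open>The functionals \<open>c\<close> read off the coordinates with respect to \<open>b\<close>; the two instances needed are
  the standard bases of \<open>\<ell>\<^sub>1\<close> and \<open>\<ell>\<^sub>\<infinity>\<close>.\<close>

lemma tensor_product_ell1_cases: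
  fixes b :: "'n::finite \<Rightarrow> 'b::real_normed_vector" and c :: "'n \<Rightarrow> 'b \<Rightarrow>\<^sub>L real"
  assumes expansion: "\<And>y. (\<Sum>j\<in>UNIV. blinfun_apply (c j) y *\<^sub>R b j) = y"
    and u: "u \<in> (tensor_product :: (('n ell1 \<Rightarrow>\<^sub>L 'b \<Rightarrow>\<^sub>L real) \<Rightarrow>\<^sub>L real) set)"
  obtains M where "u = matrix_tensor ell1_basis b M"
proof -
  have "\<exists>M. u = matrix_tensor ell1_basis b M"
    using u unfolding tensor_product_def
  proof (induction rule: span_induct_alt)
    case base
    show ?case by (rule exI[of _ "\<lambda>_ _. 0"]) (simp add: matrix_tensor_def)
  next
    case (step r t v)
    then obtain x y M where t: "t = tensor x y" and v: "v = matrix_tensor ell1_basis b M" by blast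
    have "r *\<^sub>R t + v = matrix_tensor ell1_basis b (\<lambda>i j. r * (ell1_coord i x * c j y) + M i j)"
    proof (rule blinfun_eqI)
      fix D :: "'n ell1 \<Rightarrow>\<^sub>L 'b \<Rightarrow>\<^sub>L real"
      have "D x y = D (\<Sum>i\<in>UNIV. ell1_coord i x *\<^sub>R ell1_basis i) (\<Sum>j\<in>UNIV. c j y *\<^sub>R b j)"
        by (simp add: expansion ell1_expansion)
      also have "\<dots> = (\<Sum>i\<in>UNIV. \<Sum>j\<in>UNIV. ell1_coord i x * c j y * D (ell1_basis i) (b j))"
        by (subst sum.swap) (simp add: blinfun.sum_right blinfun.sum_left blinfun.scaleR_left
            blinfun.scaleR_right sum_distrib_left mult_ac)
      finally show "(r *\<^sub>R t + v) D =
          matrix_tensor ell1_basis b (\<lambda>i j. r * (ell1_coord i x * c j y) + M i j) D"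
        by (simp add: t v blinfun.add_left blinfun.scaleR_left tensor.rep_eq matrix_tensor_apply
            sum_distrib_left algebra_simps sum.distrib)
    qed
    then show ?case by blast
  qed
  then show ?thesis using that by blast
qed

definition entries :: "('n::finite ell1 \<Rightarrow>\<^sub>L 'n ell1 \<Rightarrow>\<^sub>L real) \<Rightarrow> 'n \<Rightarrow> 'n \<Rightarrow> real" where
  "entries A i k = A (ell1_basis i) (ell1_basis k)"

text \<open>The coordinate functionals form the standard basis of \<open>(\<ell>\<^sub>1)\<^sup>* = \<ell>\<^sub>\<infinity>\<close>, so that \<open>A \<otimes> id\<close>
  becomes multiplication of matrices in these coordinates.\<close>

lemma tensor_map_id_matrix_tensor:
  assumes sym: "\<And>i k. entries A i k = entries A k i"
  shows "tensor_map_id A (matrix_tensor ell1_basis b M) =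
    matrix_tensor ell1_coord b (mat_mult (entries A) M)"
proof (rule blinfun_eqI)
  fix D
  have A: "A (ell1_basis k) = (\<Sum>i\<in>UNIV. entries A i k *\<^sub>R ell1_coord i)" for k
    using ell1_functional_expansion[of "A (ell1_basis k)"] by (simp add: entries_def[symmetric] sym)
  have "tensor_map_id A (matrix_tensor ell1_basis b M) D =
      (\<Sum>k\<in>UNIV. \<Sum>j\<in>UNIV. \<Sum>i\<in>UNIV. entries A i k * M k j * D (ell1_coord i) (b j))"
    by (simp add: tensor_map_id.rep_eq matrix_tensor_apply A blinfun.sum_right blinfun.sum_left
        blinfun.scaleR_left blinfun.scaleR_right sum_distrib_left mult_ac)
  also have "\<dots> = (\<Sum>k\<in>UNIV. \<Sum>i\<in>UNIV. \<Sum>j\<in>UNIV. entries A i k * M k j * D (ell1_coord i) (b j))"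
    by (intro sum.cong refl sum.swap)
  also have "\<dots> = (\<Sum>i\<in>UNIV. \<Sum>k\<in>UNIV. \<Sum>j\<in>UNIV. entries A i k * M k j * D (ell1_coord i) (b j))"
    by (rule sum.swap)
  also have "\<dots> = (\<Sum>i\<in>UNIV. \<Sum>j\<in>UNIV. \<Sum>k\<in>UNIV. entries A i k * M k j * D (ell1_coord i) (b j))"
    by (intro sum.cong refl sum.swap)
  also have "\<dots> = matrix_tensor ell1_coord b (mat_mult (entries A) M) D"
    by (simp add: matrix_tensor_apply mat_mult_def sum_distrib_right)
  finally show "tensor_map_id A (matrix_tensor ell1_basis b M) D =
    matrix_tensor ell1_coord b (mat_mult (entries A) M) D" .
qed

section \<open>Injective and projective norms of matrices\<close>

lemma injective_norm_ell1_ell1: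
  "injective_norm (matrix_tensor ell1_basis ell1_basis M) \<le> 1 \<longleftrightarrow> form_bounded M"
proof
  assume *: "injective_norm (matrix_tensor ell1_basis ell1_basis M) \<le> 1"
  show "form_bounded M"
    unfolding form_bounded_def
  proof safe
    fix s t :: "'a \<Rightarrow> real"
    assume "\<forall>i. \<bar>s i\<bar> \<le> 1" "\<forall>j. \<bar>t j\<bar> \<le> 1"
    then have "norm (\<Sum>i\<in>UNIV. s i *\<^sub>R ell1_coord i) \<le> 1" "norm (\<Sum>i\<in>UNIV. t i *\<^sub>R ell1_coord i) \<le> 1"
      by (auto intro: norm_ell1_functional_le)
    from *[unfolded injective_norm_le_1_iff, rule_format, OF this]
    show "\<bar>\<Sum>i\<in>UNIV. \<Sum>j\<in>UNIV. M i j * s i * t j\<bar> \<le> 1"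
      by (simp add: matrix_tensor_apply rank_one_apply ell1_functional_basis_sum mult_ac)
  qed
next
  assume *: "form_bounded M"
  show "injective_norm (matrix_tensor ell1_basis ell1_basis M) \<le> 1"
    unfolding injective_norm_le_1_iff
  proof safe
    fix \<phi> \<psi> :: "'a ell1 \<Rightarrow>\<^sub>L real"
    assume "norm \<phi> \<le> 1" "norm \<psi> \<le> 1"
    then have "\<bar>\<phi> (ell1_basis i)\<bar> \<le> 1" "\<bar>\<psi> (ell1_basis i)\<bar> \<le> 1" for i
      using ell1_functional_basis_le order_trans by blast+
    then show "\<bar>matrix_tensor ell1_basis ell1_basis M (rank_one \<phi> \<psi>)\<bar> \<le> 1"
      using * by (simp add: form_bounded_def matrix_tensor_apply rank_one_apply mult.assoc)
  qed
qed

lemma injective_norm_ell1_ellinf: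
  "injective_norm (matrix_tensor ell1_basis ellinf_basis M) \<le> 1 \<longleftrightarrow> columns_bounded M"
proof
  assume *: "injective_norm (matrix_tensor ell1_basis ellinf_basis M) \<le> 1"
  show "columns_bounded M"
    unfolding columns_bounded_def
  proof safe
    fix j
    have "norm (\<Sum>i\<in>UNIV. sgn (M i j) *\<^sub>R ell1_coord i) \<le> 1"
      by (rule norm_ell1_functional_le) (simp add: abs_sgn_eq)
    moreover have "norm (ellinf_coord j) \<le> 1"
      by (rule norm_blinfun_bound) (simp_all add: abs_ellinf_coord_le)
    ultimately have "\<bar>matrix_tensor ell1_basis ellinf_basis M
        (rank_one (\<Sum>i\<in>UNIV. sgn (M i j) *\<^sub>R ell1_coord i) (ellinf_coord j))\<bar> \<le> 1"
      using * by (simp add: injective_norm_le_1_iff)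
    then have "\<bar>\<Sum>i\<in>UNIV. M i j * sgn (M i j)\<bar> \<le> 1"
      by (simp add: matrix_tensor_apply rank_one_apply ell1_functional_basis_sum ellinf_coord_basis
          if_distrib cong: if_cong)
    then show "(\<Sum>i\<in>UNIV. \<bar>M i j\<bar>) \<le> 1"
      unfolding abs_sgn[symmetric] by linarith
  qed
next
  assume *: "columns_bounded M"
  show "injective_norm (matrix_tensor ell1_basis ellinf_basis M) \<le> 1"
    unfolding injective_norm_le_1_iff
  proof safe
    fix \<phi> :: "'a ell1 \<Rightarrow>\<^sub>L real" and \<psi> :: "'a ellinf \<Rightarrow>\<^sub>L real"
    assume \<phi>: "norm \<phi> \<le> 1" and \<psi>: "norm \<psi> \<le> 1"
    have "\<bar>matrix_tensor ell1_basis ellinf_basis M (rank_one \<phi> \<psi>)\<bar> \<le>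
       (\<Sum>i\<in>UNIV. \<Sum>j\<in>UNIV. \<bar>M i j\<bar> * \<bar>\<psi> (ellinf_basis j)\<bar>)"
      unfolding matrix_tensor_apply rank_one_apply
    proof (intro order_trans[OF sum_abs] sum_mono)
      fix i j
      have "\<bar>\<phi> (ell1_basis i)\<bar> \<le> 1" using \<phi> ell1_functional_basis_le order_trans by blast
      then have "\<bar>M i j\<bar> * (\<bar>\<phi> (ell1_basis i)\<bar> * \<bar>\<psi> (ellinf_basis j)\<bar>) \<le> \<bar>M i j\<bar> * (1 * \<bar>\<psi> (ellinf_basis j)\<bar>)"
        by (intro mult_left_mono mult_right_mono) auto
      then show "\<bar>M i j * (\<phi> (ell1_basis i) * \<psi> (ellinf_basis j))\<bar> \<le> \<bar>M i j\<bar> * \<bar>\<psi> (ellinf_basis j)\<bar>"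
        by (simp add: abs_mult)
    qed
    also have "\<dots> = (\<Sum>j\<in>UNIV. (\<Sum>i\<in>UNIV. \<bar>M i j\<bar>) * \<bar>\<psi> (ellinf_basis j)\<bar>)"
      by (subst sum.swap) (simp add: sum_distrib_right)
    also have "\<dots> \<le> (\<Sum>j\<in>UNIV. 1 * \<bar>\<psi> (ellinf_basis j)\<bar>)"
      using * by (intro sum_mono mult_right_mono) (auto simp: columns_bounded_def)
    also have "\<dots> \<le> 1"
      using sum_abs_ellinf_functional_le[of \<psi>] \<psi> by simp
    finally show "\<bar>matrix_tensor ell1_basis ellinf_basis M (rank_one \<phi> \<psi>)\<bar> \<le> 1" .
  qed
qed

text \<open>The matrix \<open>L\<close> as a bilinear form on \<open>(\<ell>\<^sub>1)\<^sup>* \<times> F\<close>: the coordinates of a functional \<open>\<phi>\<close> on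
  \<open>\<ell>\<^sub>1\<close> are its values on the basis, and those of an element of \<open>F\<close> are given by \<open>c\<close>.\<close>

definition matrix_form ::
  "('n::finite \<Rightarrow> 'b::real_normed_vector \<Rightarrow>\<^sub>L real) \<Rightarrow> ('n \<Rightarrow> 'n \<Rightarrow> real) \<Rightarrow>
   ('n ell1 \<Rightarrow>\<^sub>L real) \<Rightarrow>\<^sub>L 'b \<Rightarrow>\<^sub>L real" where
  "matrix_form c L =
     (\<Sum>i\<in>UNIV. \<Sum>j\<in>UNIV. L i j *\<^sub>R rank_one (Blinfun (\<lambda>\<phi>. blinfun_apply \<phi> (ell1_basis i))) (c j))"

lemma matrix_form_apply:
  "matrix_form c L \<phi> y = (\<Sum>i\<in>UNIV. \<Sum>j\<in>UNIV. L i j * \<phi> (ell1_basis i) * c j y)"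
  by (simp add: matrix_form_def blinfun.sum_left blinfun.scaleR_left rank_one_apply
      bounded_linear_Blinfun_apply blinfun.bounded_linear_left mult.assoc)

lemma pairing_le_projective_norm:
  assumes dual: "\<And>i j. blinfun_apply (c i) (b j) = (if i = j then 1 else 0)"
    and "\<And>\<phi> y. \<bar>\<Sum>i\<in>UNIV. \<Sum>j\<in>UNIV. L i j * blinfun_apply \<phi> (ell1_basis i) * c j y\<bar> \<le> norm \<phi> * norm y"
  shows "pairing L M \<le> projective_norm (matrix_tensor ell1_coord b M)"
proof -
  have "matrix_form c L (ell1_coord k) (b l) = L k l" for k l
  proof -
    have "matrix_form c L (ell1_coord k) (b l) =
        (\<Sum>i\<in>UNIV. \<Sum>j\<in>UNIV. if j = l then L i j * ell1_coord k (ell1_basis i) else 0)"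
      unfolding matrix_form_apply by (intro sum.cong refl) (simp add: dual)
    also have "\<dots> = (\<Sum>i\<in>UNIV. if i = k then L i l else 0)"
      by (intro sum.cong refl) (simp add: ell1_coord_basis)
    finally show ?thesis by simp
  qed
  then have "pairing L M = matrix_tensor ell1_coord b M (matrix_form c L)"
    by (simp add: matrix_tensor_apply pairing_def mult.commute)
  also have "\<dots> \<le> projective_norm (matrix_tensor ell1_coord b M)"
    using assms(2)
    by (intro apply_le_projective_norm matrix_tensor_in_tensor_product) (simp add: matrix_form_apply)
  finally show ?thesis .
qed

text \<open>Splitting a matrix into its columns gives the upper bound, and a norming matrix of signs, used
  as a bilinear form, gives the lower bound.\<close>

lemma projective_norm_ellinf_ell1:
  "projective_norm (matrix_tensor ell1_coord ell1_basis M) = column_max_sum M"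
proof (rule antisym)
  have eq: "matrix_tensor ell1_coord ell1_basis M =
      (\<Sum>j\<in>UNIV. tensor (\<Sum>i\<in>UNIV. M i j *\<^sub>R ell1_coord i) (ell1_basis j))"
    by (rule blinfun_eqI, subst matrix_tensor_apply, subst sum.swap)
       (simp add: blinfun.sum_left blinfun.scaleR_left blinfun.sum_right blinfun.scaleR_right tensor.rep_eq)
  have "projective_norm (matrix_tensor ell1_coord ell1_basis M) \<le>
      (\<Sum>j\<in>UNIV. norm (\<Sum>i\<in>UNIV. M i j *\<^sub>R ell1_coord i) * norm (ell1_basis j))"
    by (rule projective_norm_le[OF _ eq]) simp
  also have "\<dots> \<le> column_max_sum M"
    unfolding column_max_sum_def
    by (intro sum_mono) (auto simp: norm_ell1_basis intro!: norm_ell1_functional_le Max_ge)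
  finally show "projective_norm (matrix_tensor ell1_coord ell1_basis M) \<le> column_max_sum M" .
next
  obtain U where U: "columns_bounded U" and eq: "column_max_sum M = pairing U M"
    by (rule column_max_sum_eq_pairing)
  show "column_max_sum M \<le> projective_norm (matrix_tensor ell1_coord ell1_basis M)"
    unfolding eq
  proof (rule pairing_le_projective_norm[OF ell1_coord_basis])
    fix \<phi> :: "'a ell1 \<Rightarrow>\<^sub>L real" and y :: "'a ell1"
    have "\<bar>\<Sum>i\<in>UNIV. \<Sum>j\<in>UNIV. U i j * \<phi> (ell1_basis i) * ell1_coord j y\<bar> \<le>
       (\<Sum>i\<in>UNIV. \<Sum>j\<in>UNIV. \<bar>U i j\<bar> * (norm \<phi> * \<bar>ell1_coord j y\<bar>))"
    proof (intro order_trans[OF sum_abs] sum_mono)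
      fix i j
      have "\<bar>U i j\<bar> * (\<bar>\<phi> (ell1_basis i)\<bar> * \<bar>ell1_coord j y\<bar>) \<le> \<bar>U i j\<bar> * (norm \<phi> * \<bar>ell1_coord j y\<bar>)"
        by (intro mult_left_mono mult_right_mono ell1_functional_basis_le) auto
      then show "\<bar>U i j * \<phi> (ell1_basis i) * ell1_coord j y\<bar> \<le> \<bar>U i j\<bar> * (norm \<phi> * \<bar>ell1_coord j y\<bar>)"
        by (simp add: abs_mult mult.assoc)
    qed
    also have "\<dots> = (\<Sum>j\<in>UNIV. (\<Sum>i\<in>UNIV. \<bar>U i j\<bar>) * (norm \<phi> * \<bar>ell1_coord j y\<bar>))"
      by (subst sum.swap) (simp add: sum_distrib_right)
    also have "\<dots> \<le> (\<Sum>j\<in>UNIV. 1 * (norm \<phi> * \<bar>ell1_coord j y\<bar>))"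
      using U by (intro sum_mono mult_right_mono) (auto simp: columns_bounded_def)
    also have "\<dots> = norm \<phi> * norm y"
      by (simp add: norm_ell1_coords sum_distrib_left)
    finally show "\<bar>\<Sum>i\<in>UNIV. \<Sum>j\<in>UNIV. U i j * \<phi> (ell1_basis i) * ell1_coord j y\<bar> \<le> norm \<phi> * norm y" .
  qed
qed

text \<open>This lemma and \<open>projective_norm_le_of_pairing\<close> say that the dual of the projective tensor
  product \<open>\<ell>\<^sub>\<infinity> \<otimes> \<ell>\<^sub>\<infinity>\<close> is the space of bilinear forms.  Here the bound on a form over the unit cubes
  is extended by homogeneity.\<close>

lemma pairing_le_projective_norm_ellinf_ellinf:
  assumes "form_bounded L"
  shows "pairing L M \<le> projective_norm (matrix_tensor ell1_coord ellinf_basis M)"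
proof (rule pairing_le_projective_norm[OF ellinf_coord_basis])
  fix \<phi> :: "'a ell1 \<Rightarrow>\<^sub>L real" and y :: "'a ellinf"
  show "\<bar>\<Sum>i\<in>UNIV. \<Sum>j\<in>UNIV. L i j * \<phi> (ell1_basis i) * ellinf_coord j y\<bar> \<le> norm \<phi> * norm y"
  proof (cases "\<phi> = 0 \<or> y = 0")
    case False
    then have pos: "norm \<phi> > 0" "norm y > 0" by auto
    have unit: "\<bar>\<phi> (ell1_basis i) / norm \<phi>\<bar> \<le> 1" "\<bar>ellinf_coord i y / norm y\<bar> \<le> 1" for i
      using pos by (auto simp: ell1_functional_basis_le abs_ellinf_coord_le)
    have "\<bar>\<Sum>i\<in>UNIV. \<Sum>j\<in>UNIV. L i j * (\<phi> (ell1_basis i) / norm \<phi>) * (ellinf_coord j y / norm y)\<bar> \<le> 1"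
      by (rule assms[unfolded form_bounded_def, rule_format, OF unit])
    also have "(\<Sum>i\<in>UNIV. \<Sum>j\<in>UNIV. L i j * (\<phi> (ell1_basis i) / norm \<phi>) * (ellinf_coord j y / norm y))
        = (\<Sum>i\<in>UNIV. \<Sum>j\<in>UNIV. L i j * \<phi> (ell1_basis i) * ellinf_coord j y) / (norm \<phi> * norm y)"
      by (simp add: sum_divide_distrib)
    finally show ?thesis using pos by (simp add: abs_mult divide_le_eq)
  qed auto
qed

text \<open>In finite dimension the Hahn--Banach step reduces to separating a point from a compact convex
  set.  The projective unit ball of \<open>\<ell>\<^sub>\<infinity> \<otimes> \<ell>\<^sub>\<infinity>\<close> is the convex hull of the matrices \<open>(s\<^sub>i t\<^sub>j)\<close> with entries of
  \<open>s\<close> and \<open>t\<close> in \<open>[-1, 1]\<close>.  A matrix outside the ball of radius \<open>d > c\<close> is separated from it by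
  some \<open>L\<close>, which, suitably scaled, is a bounded form violating the hypothesis; a matrix
  inside it is an explicit convex combination that bounds the projective norm by \<open>d\<close>.\<close>

lemma projective_norm_le_of_pairing:
  fixes M :: "'n::finite \<Rightarrow> 'n \<Rightarrow> real"
  assumes "\<And>L. form_bounded L \<Longrightarrow> pairing L M \<le> c"
  shows "projective_norm (matrix_tensor ell1_coord ellinf_basis M) \<le> c"
proof (rule field_le_epsilon)
  fix e :: real assume "e > 0"
  define d where "d = c + e"
  have "pairing (\<lambda>_ _. 0) M \<le> c" by (rule assms) (simp add: form_bounded_def)
  then have d: "d > 0" "d > c" using \<open>e > 0\<close> by (auto simp: d_def pairing_def)
  define box where "box = (cbox (\<chi> i. -1) (\<chi> i. 1) :: (real ^ 'n) set)"
  have box: "s \<in> box \<longleftrightarrow> (\<forall>i. \<bar>s $ i\<bar> \<le> 1)" for s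
    by (auto simp: box_def mem_box_cart abs_le_iff)
  define S where "S = (\<lambda>(s, t). (\<chi> i j. s $ i * t $ j) :: real ^ 'n ^ 'n) ` (box \<times> box)"
  have S: "(\<chi> i j. s i * t j) \<in> S" if "\<forall>i. \<bar>s i\<bar> \<le> 1" "\<forall>j. \<bar>t j\<bar> \<le> 1" for s t :: "'n \<Rightarrow> real"
    unfolding S_def by (rule image_eqI[of _ _ "(\<chi> i. s i, \<chi> j. t j)"]) (use that in \<open>auto simp: box\<close>)
  have "compact S"
    unfolding S_def case_prod_unfold
    by (intro compact_continuous_image compact_Times continuous_intros) (simp_all add: box_def)
  then have closed: "closed (convex hull S)" by (intro compact_imp_closed compact_convex_hull)
  define m :: "real ^ 'n ^ 'n" where "m = (\<chi> i j. M i j / d)"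
  have inner: "L \<bullet> (\<chi> i j. N i j) = pairing (\<lambda>i j. L $ i $ j) N" for L :: "real ^ 'n ^ 'n" and N
    by (simp add: inner_vec_def pairing_def)
  have "m \<in> convex hull S"
  proof (rule ccontr)
    assume "m \<notin> convex hull S"
    from separating_hyperplane_closed_point[OF convex_convex_hull closed this]
    obtain L b where b: "L \<bullet> m < b" "\<And>x. x \<in> convex hull S \<Longrightarrow> b < L \<bullet> x" by blast
    \<comment> \<open>The hull contains 0, so that \<open>b\<close> is negative, and division by \<open>b\<close> reverses the inequalities.\<close>
    have "b < L \<bullet> (\<chi> i j. 0 * 0)"
      by (intro b(2) hull_inc S) auto
    then have "b < 0" by (simp add: zero_vec_def[symmetric])
    define N where "N i j = L $ i $ j / b" for i j
    have "form_bounded N"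
      unfolding form_bounded_def
    proof safe
      have *: "(\<Sum>i\<in>UNIV. \<Sum>j\<in>UNIV. N i j * s i * t j) \<le> 1"
        if "\<forall>i. \<bar>s i\<bar> \<le> 1" "\<forall>j. \<bar>t j\<bar> \<le> 1" for s t :: "'n \<Rightarrow> real"
      proof -
        have "b < L \<bullet> (\<chi> i j. s i * t j)" by (intro b(2) hull_inc S that)
        then have "(L \<bullet> (\<chi> i j. s i * t j)) / b \<le> 1" using \<open>b < 0\<close> by (simp add: divide_le_eq)
        then show ?thesis
          unfolding inner by (simp add: pairing_def N_def sum_divide_distrib mult_ac)
      qed
      fix s t :: "'n \<Rightarrow> real"
      assume st: "\<forall>i. \<bar>s i\<bar> \<le> 1" "\<forall>j. \<bar>t j\<bar> \<le> 1"
      \<comment> \<open>The cube is symmetric, so the one-sided bound holds for the absolute value as well.\<close>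
      from *[OF this] *[of "\<lambda>i. - s i", OF _ st(2)] st(1)
      show "\<bar>\<Sum>i\<in>UNIV. \<Sum>j\<in>UNIV. N i j * s i * t j\<bar> \<le> 1"
        by (simp add: sum_negf abs_le_iff)
    qed
    from assms[OF this] have "pairing N M \<le> c" .
    moreover have "pairing N M > d"
    proof -
      have "pairing (\<lambda>i j. L $ i $ j) M / d = L \<bullet> m"
        unfolding m_def inner by (simp add: pairing_def sum_divide_distrib)
      also have "\<dots> < b" by (rule b(1))
      finally have "d < pairing (\<lambda>i j. L $ i $ j) M / b"
        using d \<open>b < 0\<close> by (simp add: divide_less_eq less_divide_eq mult.commute)
      then show ?thesis by (simp add: N_def pairing_def sum_divide_distrib)
    qed
    ultimately show False using d by simp
  qed
  then obtain k u x where u: "\<And>r. r \<in> {1..k} \<Longrightarrow> 0 \<le> u r" "sum u {1..k} = 1"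
    and x: "\<And>r. r \<in> {1::nat..k} \<Longrightarrow> x r \<in> S" and m: "(\<Sum>r=1..k. u r *\<^sub>R x r) = m"
    unfolding convex_hull_indexed by blast
  have "\<forall>r\<in>{1..k}. \<exists>s t. (\<forall>i. \<bar>s i\<bar> \<le> 1) \<and> (\<forall>j. \<bar>t j\<bar> \<le> 1) \<and> x r = (\<chi> i j. s i * t j)"
  proof
    fix r assume "r \<in> {1..k}"
    then obtain s t where "s \<in> box" "t \<in> box" "x r = (\<chi> i j. s $ i * t $ j)"
      using x[of r] unfolding S_def by auto
    then show "\<exists>s t. (\<forall>i. \<bar>s i\<bar> \<le> 1) \<and> (\<forall>j. \<bar>t j\<bar> \<le> 1) \<and> x r = (\<chi> i j. s i * t j)"
      unfolding box by blast
  qed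
  then obtain s t where st: "\<And>r i. r \<in> {1..k} \<Longrightarrow> \<bar>s r i\<bar> \<le> 1" "\<And>r j. r \<in> {1..k} \<Longrightarrow> \<bar>t r j\<bar> \<le> 1"
    "\<And>r. r \<in> {1..k} \<Longrightarrow> x r = (\<chi> i j. s r i * t r j)"
    unfolding bchoice_iff by metis
  let ?f = "\<lambda>r. \<Sum>i\<in>UNIV. s r i *\<^sub>R (ell1_coord i :: 'n ell1 \<Rightarrow>\<^sub>L real)"
  let ?y = "\<lambda>r. \<Sum>j\<in>UNIV. t r j *\<^sub>R (ellinf_basis j :: 'n ellinf)"
  have M: "M i j = (\<Sum>r=1..k. d * u r * (s r i * t r j))" for i j
  proof -
    have "M i j = d * m $ i $ j" using d by (simp add: m_def)
    then show ?thesis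
      by (simp add: m[symmetric] st(3) sum_distrib_left mult.assoc)
  qed
  have "matrix_tensor ell1_coord ellinf_basis M = (\<Sum>r=1..k. tensor ((d * u r) *\<^sub>R ?f r) (?y r))"
  proof (rule blinfun_eqI)
    fix D :: "('n ell1 \<Rightarrow>\<^sub>L real) \<Rightarrow>\<^sub>L 'n ellinf \<Rightarrow>\<^sub>L real"
    let ?g = "\<lambda>i j r. d * u r * (s r i * t r j) * D (ell1_coord i) (ellinf_basis j)"
    have "matrix_tensor ell1_coord ellinf_basis M D = (\<Sum>i\<in>UNIV. \<Sum>j\<in>UNIV. \<Sum>r=1..k. ?g i j r)"
      by (simp add: matrix_tensor_apply M sum_distrib_right)
    also have "\<dots> = (\<Sum>i\<in>UNIV. \<Sum>r=1..k. \<Sum>j\<in>UNIV. ?g i j r)"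
      by (intro sum.cong refl sum.swap)
    also have "\<dots> = (\<Sum>r=1..k. \<Sum>i\<in>UNIV. \<Sum>j\<in>UNIV. ?g i j r)"
      by (rule sum.swap)
    also have "\<dots> = (\<Sum>r=1..k. tensor ((d * u r) *\<^sub>R ?f r) (?y r)) D"
      unfolding blinfun.sum_left tensor.rep_eq blinfun.scaleR_left blinfun.scaleR_right
        blinfun.sum_right real_scaleR_def sum_distrib_left
      by (rule sum.cong[OF refl], subst sum.swap, intro sum.cong refl) (simp add: mult_ac)
    finally show "matrix_tensor ell1_coord ellinf_basis M D
      = (\<Sum>r=1..k. tensor ((d * u r) *\<^sub>R ?f r) (?y r)) D" .
  qed
  then have "projective_norm (matrix_tensor ell1_coord ellinf_basis M) \<le>
      (\<Sum>r=1..k. norm ((d * u r) *\<^sub>R ?f r) * norm (?y r))"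
    by (intro projective_norm_le) auto
  also have "\<dots> \<le> (\<Sum>r=1..k. d * u r)"
  proof (rule sum_mono)
    fix r assume r: "r \<in> {1..k}"
    then have "norm (?f r) \<le> 1" "norm (?y r) \<le> 1"
      using st by (auto intro!: norm_ell1_functional_le norm_ellinf_sum_le)
    then have "(d * u r) * (norm (?f r) * norm (?y r)) \<le> (d * u r) * 1"
      using d u(1)[OF r] by (intro mult_left_mono mult_le_one) auto
    then show "norm ((d * u r) *\<^sub>R ?f r) * norm (?y r) \<le> d * u r"
      using d u(1)[OF r] by (simp add: abs_mult mult.assoc)
  qed
  also have "\<dots> = c + e" using u(2) by (simp add: d_def sum_distrib_left[symmetric])
  finally show "projective_norm (matrix_tensor ell1_coord ellinf_basis M) \<le> c + e" .
qed

section \<open>Positive maps and Gram matrices\<close>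

text \<open>A convex combination \<open>\<Sum>\<^sub>r u\<^sub>r \<phi>\<^sub>r \<otimes> \<phi>\<^sub>r\<close> is the Gram matrix of the vectors with components
  \<open>\<surd>u\<^sub>r \<phi>\<^sub>r(e\<^sub>i)\<close>.\<close>

lemma positive_map_gram:
  assumes "positive_map A"
  obtains N and x :: "'n::finite \<Rightarrow> nat \<Rightarrow> real"
  where "\<And>i k. entries A i k = (\<Sum>r=1..N. x i r * x k r)"
proof -
  from assms obtain N u B where u: "\<And>r. r \<in> {1::nat..N} \<Longrightarrow> 0 \<le> u r"
    and B: "\<And>r. r \<in> {1..N} \<Longrightarrow> B r \<in> {rank_one \<phi> \<phi> | \<phi>. True}"
    and A: "(\<Sum>r=1..N. u r *\<^sub>R B r) = A"
    unfolding positive_map_def convex_hull_indexed by blast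
  from B have "\<forall>r\<in>{1..N}. \<exists>\<phi>. B r = rank_one \<phi> \<phi>" by blast
  then obtain \<phi> where \<phi>: "\<And>r. r \<in> {1..N} \<Longrightarrow> B r = rank_one (\<phi> r) (\<phi> r)" by metis
  show ?thesis
  proof (rule that[of "\<lambda>i r. sqrt (u r) * \<phi> r (ell1_basis i)" N])
    fix i k
    have "entries A i k = (\<Sum>r=1..N. u r * (\<phi> r (ell1_basis i) * \<phi> r (ell1_basis k)))"
      by (simp add: entries_def A[symmetric] blinfun.sum_left blinfun.scaleR_left \<phi> rank_one_apply)
    also have "\<dots> = (\<Sum>r=1..N. sqrt (u r) * \<phi> r (ell1_basis i) * (sqrt (u r) * \<phi> r (ell1_basis k)))"
    proof (intro sum.cong refl)
      fix r assume "r \<in> {1..N}"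
      then have "u r = sqrt (u r) * sqrt (u r)" using u by simp
      then show "u r * (\<phi> r (ell1_basis i) * \<phi> r (ell1_basis k)) =
         sqrt (u r) * \<phi> r (ell1_basis i) * (sqrt (u r) * \<phi> r (ell1_basis k))"
        by (metis mult.assoc mult.left_commute)
    qed
    finally show "entries A i k = \<dots>" .
  qed
qed

lemma entries_sym:
  assumes "positive_map A"
  shows "entries A i k = entries A k i"
proof -
  obtain N and x :: "'a \<Rightarrow> nat \<Rightarrow> real" where "\<And>i k. entries A i k = (\<Sum>r=1..N. x i r * x k r)"
    using positive_map_gram[OF assms] by metis
  then show ?thesis by (simp add: mult.commute)
qed

lemma abs_entries_le: "\<bar>entries A i k\<bar> \<le> norm A"
proof -
  have "\<bar>entries A i k\<bar> \<le> norm (A (ell1_basis i))"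
    unfolding entries_def by (rule ell1_functional_basis_le)
  also have "\<dots> \<le> norm A * norm (ell1_basis i)" by (rule norm_blinfun)
  finally show ?thesis by (simp add: norm_ell1_basis)
qed

section \<open>The common value of the two constants\<close>

definition gram_constant :: "'n::finite itself \<Rightarrow> ereal" where
  "gram_constant _ =
     (SUP A\<in>{A :: 'n ell1 \<Rightarrow>\<^sub>L 'n ell1 \<Rightarrow>\<^sub>L real. positive_map A \<and> norm A \<le> 1}.
      SUP M\<in>{M. form_bounded M}. ereal (column_max_sum (mat_mult (entries A) M)))"

lemma KG_plus_ell1_ell1: "KG_plus TYPE('n::finite ell1) TYPE('n ell1) = gram_constant TYPE('n)"
  unfolding KG_plus_def gram_constant_def
proof (rule SUP_cong[OF refl])
  fix A :: "'n ell1 \<Rightarrow>\<^sub>L 'n ell1 \<Rightarrow>\<^sub>L real"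
  assume "A \<in> {A. positive_map A \<and> norm A \<le> 1}"
  then have sym: "\<And>i k. entries A i k = entries A k i" by (simp add: entries_sym)
  have "{u \<in> tensor_product. injective_norm u \<le> 1} =
     matrix_tensor ell1_basis (ell1_basis :: 'n \<Rightarrow> _) ` {M. form_bounded M}"
    by (auto simp: injective_norm_ell1_ell1 matrix_tensor_in_tensor_product
        elim!: tensor_product_ell1_cases[OF ell1_expansion])
  then show "injective_projective_onorm
      (tensor_map_id A :: (('n ell1 \<Rightarrow>\<^sub>L 'n ell1 \<Rightarrow>\<^sub>L real) \<Rightarrow>\<^sub>L real) \<Rightarrow> _) =
      (SUP M\<in>{M. form_bounded M}. ereal (column_max_sum (mat_mult (entries A) M)))"
    by (simp add: injective_projective_onorm_def image_image tensor_map_id_matrix_tensor[OF sym]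
        projective_norm_ellinf_ell1)
qed

text \<open>The operator for \<open>F = \<ell>\<^sub>\<infinity>\<close> is the adjoint of the one for \<open>F = \<ell>\<^sub>1\<close>.  For \<open>U\<close> in the unit
  ball of \<open>\<ell>\<^sub>\<infinity>(\<ell>\<^sub>1)\<close> and a bounded form \<open>L\<close>, the self-adjointness of \<open>a\<close> gives
  \<open>\<langle>L, a U\<rangle> = \<langle>U, a L\<rangle>\<close>; the supremum over \<open>L\<close> yields the projective norm of \<open>a U\<close> in \<open>\<ell>\<^sub>\<infinity> \<otimes> \<ell>\<^sub>\<infinity>\<close>,
  and the supremum over \<open>U\<close> yields the norm of \<open>a L\<close> in \<open>\<ell>\<^sub>1(\<ell>\<^sub>\<infinity>)\<close>.\<close>

lemma KG_plus_ell1_ellinf: "KG_plus TYPE('n::finite ell1) TYPE('n ellinf) = gram_constant TYPE('n)"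
  unfolding KG_plus_def gram_constant_def
proof (rule SUP_cong[OF refl])
  fix A :: "'n ell1 \<Rightarrow>\<^sub>L 'n ell1 \<Rightarrow>\<^sub>L real"
  assume "A \<in> {A. positive_map A \<and> norm A \<le> 1}"
  then have sym: "\<And>i k. entries A i k = entries A k i" by (simp add: entries_sym)
  let ?p = "\<lambda>U. projective_norm (matrix_tensor ell1_coord ellinf_basis (mat_mult (entries A) U))"
  have "{u \<in> tensor_product. injective_norm u \<le> 1} =
     matrix_tensor ell1_basis (ellinf_basis :: 'n \<Rightarrow> _) ` {M. columns_bounded M}"
    by (auto simp: injective_norm_ell1_ellinf matrix_tensor_in_tensor_product
        elim!: tensor_product_ell1_cases[OF ellinf_expansion])
  then have "injective_projective_onorm (tensor_map_id A :: (('n ell1 \<Rightarrow>\<^sub>L 'n ellinf \<Rightarrow>\<^sub>L real) \<Rightarrow>\<^sub>L real) \<Rightarrow> _) =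
      (SUP U\<in>{U. columns_bounded U}. ereal (?p U))"
    by (simp add: injective_projective_onorm_def image_image tensor_map_id_matrix_tensor[OF sym])
  also have "\<dots> = (SUP L\<in>{L. form_bounded L}. ereal (column_max_sum (mat_mult (entries A) L)))"
    (is "_ = ?Q")
  proof (rule antisym)
    show "(SUP U\<in>{U. columns_bounded U}. ereal (?p U)) \<le> ?Q"
    proof (rule SUP_least)
      fix U assume "U \<in> {U :: 'n \<Rightarrow> 'n \<Rightarrow> real. columns_bounded U}"
      then have *: "ereal (pairing L (mat_mult (entries A) U)) \<le> ?Q" if "form_bounded L" for L
        using that pairing_le_column_max_sum[of U "mat_mult (entries A) L"]
        by (intro SUP_upper2[of L])
           (auto simp: pairing_mat_mult[OF sym, of L])
      show "ereal (?p U) \<le> ?Q"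
      \<comment> \<open>\<open>projective_norm_le_of_pairing\<close> takes a real bound, so the infinite values of \<open>?Q\<close> are treated apart.\<close>
      proof (cases ?Q)
        case (real r)
        with * show ?thesis by (simp add: projective_norm_le_of_pairing)
      next
        case MInf
        with *[of "\<lambda>_ _. 0"] show ?thesis by (simp add: form_bounded_def)
      qed simp
    qed
    show "?Q \<le> (SUP U\<in>{U. columns_bounded U}. ereal (?p U))"
    proof (rule SUP_least)
      fix L assume "L \<in> {L :: 'n \<Rightarrow> 'n \<Rightarrow> real. form_bounded L}"
      then have L: "form_bounded L" by simp
      obtain U where U: "columns_bounded U"
        and eq: "column_max_sum (mat_mult (entries A) L) = pairing U (mat_mult (entries A) L)"
        by (rule column_max_sum_eq_pairing)
      have "pairing U (mat_mult (entries A) L) = pairing L (mat_mult (entries A) U)"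
        by (rule pairing_mat_mult[OF sym])
      also have "\<dots> \<le> ?p U" by (rule pairing_le_projective_norm_ellinf_ellinf[OF L])
      finally show "ereal (column_max_sum (mat_mult (entries A) L))
          \<le> (SUP U\<in>{U. columns_bounded U}. ereal (?p U))"
        using U unfolding eq by (intro SUP_upper2[of U]) auto
    qed
  qed
  finally show "injective_projective_onorm
      (tensor_map_id A :: (('n ell1 \<Rightarrow>\<^sub>L 'n ellinf \<Rightarrow>\<^sub>L real) \<Rightarrow>\<^sub>L real) \<Rightarrow> _) = ?Q" .
qed

section \<open>Grothendieck's constant\<close>

lemma ell2_inner_finite:
  assumes "\<And>r. r > Suc N \<Longrightarrow> v r = 0"
  shows "ell2_inner v w = v 0 * w 0 + (\<Sum>r=1..N. v r * w r) + v (Suc N) * w (Suc N)"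
proof -
  have "ell2_inner v w = (\<Sum>r\<in>{0..Suc N}. v r * w r)"
    unfolding ell2_inner_def by (rule suminf_finite) (auto simp: assms not_le)
  also have "\<dots> = v 0 * w 0 + (\<Sum>r=1..N. v r * w r) + v (Suc N) * w (Suc N)"
    by (simp add: sum.atLeast_Suc_atMost)
  finally show ?thesis .
qed

lemma ell2_unit_finite:
  assumes "\<And>r. r > Suc N \<Longrightarrow> v r = 0" "(v 0)\<^sup>2 + (\<Sum>r=1..N. (v r)\<^sup>2) + (v (Suc N))\<^sup>2 = 1"
  shows "ell2_unit v"
  unfolding ell2_unit_def
proof
  show "summable (\<lambda>k. (v k)\<^sup>2)"
    by (rule summable_finite[of "{0..Suc N}"]) (auto simp: assms(1) not_le)
  show "sqrt (ell2_inner v v) = 1"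
    using assms(2) by (simp add: ell2_inner_finite[where N = N, OF assms(1)] power2_eq_square)
qed

text \<open>The definition of the Grothendieck constant asks for unit vectors.  Vectors in the unit ball of
  a finite-dimensional space become unit vectors of \<open>\<ell>\<^sub>2\<close> if the missing length is put into a
  coordinate of its own: coordinate 0 for the vectors \<open>x\<^sub>i\<close> and coordinate \<open>N + 1\<close> for
  the vectors \<open>y\<^sub>j\<close>, so that all inner products \<open>\<langle>x\<^sub>i, y\<^sub>j\<rangle>\<close> stay the same.\<close>

lemma pairing_le_grothendieck_constant:
  fixes M :: "'n::finite \<Rightarrow> 'n \<Rightarrow> real" and N :: nat
  assumes M: "form_bounded M"
    and x: "\<And>i. (\<Sum>r=1..N. (x i r)\<^sup>2) \<le> 1" and y: "\<And>j. (\<Sum>r=1..N. (y j r)\<^sup>2) \<le> 1"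
  shows "ereal (pairing M (\<lambda>i j. \<Sum>r=1..N. x i r * y j r)) \<le> grothendieck_constant"
proof -
  define n where "n = CARD('n)"
  obtain h :: "nat \<Rightarrow> 'n" where h: "bij_betw h {..<n} UNIV"
    using ex_bij_betw_nat_finite[of "UNIV :: 'n set"] by (auto simp: n_def atLeast0LessThan)
  have reindex: "(\<Sum>i\<in>UNIV. \<Sum>j\<in>UNIV. g i j) = (\<Sum>i<n. \<Sum>j<n. g (h i) (h j))"
    for g :: "'n \<Rightarrow> 'n \<Rightarrow> real"
    by (simp add: sum.reindex_bij_betw[OF h, symmetric])
  define a where "a i j = M (h i) (h j)" for i j
  define v where "v i r = (if r = 0 then sqrt (1 - (\<Sum>r=1..N. (x (h i) r)\<^sup>2))
      else if r \<le> N then x (h i) r else 0)" for i r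
  define w where "w j r = (if r = Suc N then sqrt (1 - (\<Sum>r=1..N. (y (h j) r)\<^sup>2))
      else if 0 < r \<and> r \<le> N then y (h j) r else 0)" for j r
  have inner: "ell2_inner (v i) (w j) = (\<Sum>r=1..N. x (h i) r * y (h j) r)" for i j
    by (subst ell2_inner_finite[where N = N]) (auto simp: v_def w_def intro!: sum.cong)
  have vw: "ell2_unit (v i)" "ell2_unit (w i)" for i
  proof -
    have "(\<Sum>r=1..N. (v i r)\<^sup>2) = (\<Sum>r=1..N. (x (h i) r)\<^sup>2)"
      "(\<Sum>r=1..N. (w i r)\<^sup>2) = (\<Sum>r=1..N. (y (h i) r)\<^sup>2)"
      by (auto simp: v_def w_def intro!: sum.cong)
    moreover have "(v i 0)\<^sup>2 = 1 - (\<Sum>r=1..N. (x (h i) r)\<^sup>2)" "v i (Suc N) = 0"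
      "w i 0 = 0" "(w i (Suc N))\<^sup>2 = 1 - (\<Sum>r=1..N. (y (h i) r)\<^sup>2)"
      using x[of "h i"] y[of "h i"] by (simp_all add: v_def w_def)
    ultimately show "ell2_unit (v i)" "ell2_unit (w i)"
      by (intro ell2_unit_finite[where N = N]; simp add: v_def w_def)+
  qed
  have "matrix_sup_norm n n a \<le> 1"
    unfolding matrix_sup_norm_def
  proof (rule Sup_least, clarsimp)
    fix s t :: "nat \<Rightarrow> real"
    assume st: "\<forall>i<n. \<bar>s i\<bar> \<le> 1" "\<forall>i<n. \<bar>t i\<bar> \<le> 1"
    define g where "g = inv_into {..<n} h"
    have g: "g i < n" for i
      using bij_betw_inv_into[OF h] by (auto simp: g_def bij_betw_def)
    have gh: "g (h i) = i" if "i < n" for i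
      using h that by (simp add: g_def bij_betw_def)
    have "\<bar>\<Sum>i\<in>UNIV. \<Sum>j\<in>UNIV. M i j * s (g i) * t (g j)\<bar> \<le> 1"
      using M st g unfolding form_bounded_def by simp
    then show "\<bar>\<Sum>i<n. \<Sum>j<n. a i j * s i * t j\<bar> \<le> 1"
      by (simp add: reindex gh a_def)
  qed
  then have "ereal \<bar>\<Sum>i<n. \<Sum>j<n. a i j * ell2_inner (v i) (w j)\<bar> \<le> grothendieck_constant"
    unfolding grothendieck_constant_def using vw by (intro Sup_upper) blast
  moreover have "pairing M (\<lambda>i j. \<Sum>r=1..N. x i r * y j r) = (\<Sum>i<n. \<Sum>j<n. a i j * ell2_inner (v i) (w j))"
    by (simp add: pairing_def reindex inner a_def)
  ultimately show ?thesis
    by (auto intro: order_trans[rotated])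
qed

lemma gram_constant_le: "gram_constant TYPE('n::finite) \<le> grothendieck_constant"
  unfolding gram_constant_def
proof (intro SUP_least)
  fix A :: "'n ell1 \<Rightarrow>\<^sub>L 'n ell1 \<Rightarrow>\<^sub>L real" and M :: "'n \<Rightarrow> 'n \<Rightarrow> real"
  assume "A \<in> {A. positive_map A \<and> norm A \<le> 1}" "M \<in> {M. form_bounded M}"
  then have A: "positive_map A" "norm A \<le> 1" and M: "form_bounded M" by auto
  obtain N and x :: "'n \<Rightarrow> nat \<Rightarrow> real"
    where x: "\<And>i k. entries A i k = (\<Sum>r=1..N. x i r * x k r)"
    using positive_map_gram[OF A(1)] by metis
  have x1: "(\<Sum>r=1..N. (x i r)\<^sup>2) \<le> 1" for i
    using abs_entries_le[of A i i] A(2) unfolding x power2_eq_square by linarith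
  obtain f :: "'n \<Rightarrow> 'n" and e where e: "\<And>j. \<bar>e j\<bar> \<le> 1"
    and eq: "column_max_sum (mat_mult (entries A) M) = (\<Sum>j\<in>UNIV. e j * mat_mult (entries A) M (f j) j)"
    using column_max_sum_attained[of "mat_mult (entries A) M"] by metis
  \<comment> \<open>The sign and the choice of the row for column \<open>j\<close> are absorbed into the second family of vectors.\<close>
  define y where "y j r = e j * x (f j) r" for j r
  have y1: "(\<Sum>r=1..N. (y j r)\<^sup>2) \<le> 1" for j
  proof -
    have "(\<Sum>r=1..N. (y j r)\<^sup>2) = (e j)\<^sup>2 * (\<Sum>r=1..N. (x (f j) r)\<^sup>2)"
      by (simp add: y_def power_mult_distrib sum_distrib_left)
    also have "\<dots> \<le> 1"
      using e[of j] x1[of "f j"] by (intro mult_le_one sum_nonneg) (auto simp: abs_square_le_1)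
    finally show ?thesis .
  qed
  have "column_max_sum (mat_mult (entries A) M) =
      (\<Sum>j\<in>UNIV. \<Sum>k\<in>UNIV. M k j * (\<Sum>r=1..N. x k r * y j r))"
    unfolding eq by (simp add: mat_mult_def x y_def sum_distrib_left sum_distrib_right mult_ac)
  also have "\<dots> = pairing M (\<lambda>k j. \<Sum>r=1..N. x k r * y j r)"
    unfolding pairing_def by (rule sum.swap)
  finally show "ereal (column_max_sum (mat_mult (entries A) M)) \<le> grothendieck_constant"
    using pairing_le_grothendieck_constant[OF M x1 y1] by simp
qed

theorem proposition5p12:
  shows "KG_plus TYPE('n::finite ell1) TYPE('n ell1) = KG_plus TYPE('n ell1) TYPE('n ellinf) \<and>
         KG_plus TYPE('n ell1) TYPE('n ellinf) \<le> grothendieck_constant"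
  by (simp add: KG_plus_ell1_ell1 KG_plus_ell1_ellinf gram_constant_le)

end
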